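(* Let $m\ge2$, $n\ge1$, let $\mathcal{A}=(a_{i_1\cdots i_m})\in T_{m,n}$ and let $\lambda$ be an H-eigenvalue of $\mathcal{A}$. If $m$ is odd or $n=2$, then $$\lambda\in\bigcup_{i=1}^n\left[a_{ii\cdots i}-r_i^+-\sum_{(i_2,\dots,i_m)\ne(i,\dots,i)}(r_i^+-a_{ii_2\cdots i_m}),\ \ a_{ii\cdots i}-r_i^-+\sum_{(i_2,\dots,i_m)\ne(i,\dots,i)}(a_{ii_2\cdots i_m}-r_i^-)\right],$$ where for $i\in[n]$, $r_i^+=\max\{0,\,a_{ij_2\cdots j_m}:(j_2,\dots,j_m)\ne(i,\dots,i)\}$ and $r_i^-=\min\{0,\,a_{ij_2\cdots j_m}:(j_2,\dots,j_m)\ne(i,\dots,i)\}$.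
   Context: $[n]=\{1,\dots,n\}$. $T_{m,n}$ is the set of real $m$th order $n$-dimensional tensors $\mathcal{A}=(a_{i_1\cdots i_m})$, $i_1,\dots,i_m\in[n]$ (not necessarily symmetric). Sums over $(i_2,\dots,i_m)$ range over tuples in $[n]^{m-1}$. A real number $\lambda$ is an H-eigenvalue of $\mathcal{A}$ if there is a nonzero real vector $\mathbf{x}\in\mathbb{R}^n$ with $\mathcal{A}\mathbf{x}^{m-1}=\lambda\mathbf{x}^{[m-1]}$, where $(\mathcal{A}\mathbf{x}^{m-1})_i=\sum_{i_2,\dots,i_m=1}^n a_{ii_2\cdots i_m}x_{i_2}\cdots x_{i_m}$ and $\mathbf{x}^{[m-1]}=(x_1^{m-1},\dots,x_n^{m-1})^\top$. *)

theory Defs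
  imports "HOL-Analysis.Analysis"
begin

text \<open>
  A real tensor of order \<open>m\<close> and dimension \<open>n = CARD('n)\<close> is a function on index lists:
  its entries are the values on the lists of length \<open>m\<close>, and its values on lists of any other
  length are never used.  The order is therefore an explicit parameter below.
\<close>

type_synonym 'n tensor = "'n list \<Rightarrow> real"

definition tuples :: "nat \<Rightarrow> 'n::finite list set" where
  "tuples k = {js. length js = k}"

definition tensor_apply :: "nat \<Rightarrow> 'n::finite tensor \<Rightarrow> real ^ 'n \<Rightarrow> real ^ 'n" where
  "tensor_apply m A x =
    (\<chi> i. \<Sum>js\<in>tuples (m - 1). A (i # js) * (\<Prod>j\<leftarrow>js. x $ j))"

definition vec_power :: "real ^ 'n::finite \<Rightarrow> nat \<Rightarrow> real ^ 'n" where
  "vec_power x k = (\<chi> i. (x $ i) ^ k)"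

definition H_eigenvalue :: "nat \<Rightarrow> 'n::finite tensor \<Rightarrow> real \<Rightarrow> bool" where
  "H_eigenvalue m A l \<longleftrightarrow>
    (\<exists>x. x \<noteq> 0 \<and> tensor_apply m A x = l *\<^sub>R vec_power x (m - 1))"

definition offdiag :: "nat \<Rightarrow> 'n::finite \<Rightarrow> 'n list set" where
  "offdiag m i = tuples (m - 1) - {replicate (m - 1) i}"

definition r_plus :: "nat \<Rightarrow> 'n::finite tensor \<Rightarrow> 'n \<Rightarrow> real" where
  "r_plus m A i = Max (insert 0 ((\<lambda>js. A (i # js)) ` offdiag m i))"

definition r_minus :: "nat \<Rightarrow> 'n::finite tensor \<Rightarrow> 'n \<Rightarrow> real" where
  "r_minus m A i = Min (insert 0 ((\<lambda>js. A (i # js)) ` offdiag m i))"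

end

theory Submission
  imports Defs
begin

text \<open>
  Normalise an eigenvector at a coordinate \<open>i\<close> of largest modulus, so that \<open>y\<^sub>i = 1\<close> and
  \<open>\<bar>y\<^sub>j\<bar> \<le> 1\<close>.  As the monomials of degree \<open>m - 1\<close> in \<open>y\<close> add up to \<open>T\<^sup>m\<^sup>-\<^sup>1\<close> with
  \<open>T = \<Sum>\<^sub>j y\<^sub>j\<close>, any constant \<open>c\<close> can be split off from the \<open>i\<close>-th eigenvalue equation:
  \<open>\<lambda> - a\<^sub>i\<^sub>\<dots>\<^sub>i + c = c T\<^sup>m\<^sup>-\<^sup>1 - \<Sum> (c - a) y\<dots>y\<close>.  The hypothesis on \<open>m\<close> and \<open>n\<close> makes
  \<open>T\<^sup>m\<^sup>-\<^sup>1\<close> nonnegative: either \<open>m - 1\<close> is even, or \<open>T = 1 + y\<^sub>j \<ge> 0\<close>.  Taking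
  \<open>c = r\<^sub>i\<^sup>+ \<ge> 0\<close> and \<open>c = r\<^sub>i\<^sup>- \<le> 0\<close> gives the two bounds at the same index \<open>i\<close>.
\<close>

lemma finite_tuples: "finite (tuples k :: 'n::finite list set)"
  using finite_lists_length_eq[of "UNIV :: 'n set" k] by (simp add: tuples_def)

lemma tuples_Suc: "tuples (Suc k) = (\<lambda>(j, js). j # js) ` (UNIV \<times> tuples k)"
  by (force simp: tuples_def length_Suc_conv)

text \<open>Expanding the power by distributivity gives one monomial per index list; the induction
  splits off the first index.\<close>

lemma sum_prod_list_tuples:
  fixes f :: "'n::finite \<Rightarrow> 'a::comm_semiring_1"
  shows "(\<Sum>js\<in>tuples k. \<Prod>j\<leftarrow>js. f j) = (\<Sum>j\<in>UNIV. f j) ^ k"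
proof (induction k)
  case 0
  show ?case by (simp add: tuples_def)
next
  case (Suc k)
  have "inj_on (\<lambda>(j, js). j # js) (UNIV \<times> tuples k :: ('n \<times> 'n list) set)"
    by (auto simp: inj_on_def)
  then have "(\<Sum>js\<in>tuples (Suc k). \<Prod>j\<leftarrow>js. f j)
      = (\<Sum>(j, js)\<in>UNIV \<times> tuples k. f j * (\<Prod>j\<leftarrow>js. f j))"
    by (simp add: tuples_Suc sum.reindex case_prod_unfold)
  also have "\<dots> = (\<Sum>j\<in>UNIV. f j) * (\<Sum>js\<in>tuples k. \<Prod>j\<leftarrow>js. f j)"
    by (simp add: sum.cartesian_product[symmetric] sum_product)
  finally show ?case by (simp add: Suc.IH)
qed

lemma prod_list_divide:
  fixes c :: "'a::field"
  shows "(\<Prod>j\<leftarrow>js. f j / c) = (\<Prod>j\<leftarrow>js. f j) / c ^ length js"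
  by (induction js) auto

lemma abs_prod_list_le_1:
  fixes f :: "'n \<Rightarrow> 'a::linordered_idom"
  assumes "\<And>j. \<bar>f j\<bar> \<le> 1"
  shows "\<bar>\<Prod>j\<leftarrow>js. f j\<bar> \<le> 1"
  using assms by (induction js) (auto simp: abs_mult intro!: mult_le_one)

lemma sum_tuples_offdiag:
  "(\<Sum>js\<in>tuples (m - 1). f js) = f (replicate (m - 1) i) + (\<Sum>js\<in>offdiag m i. f js)"
  unfolding offdiag_def by (intro sum.remove finite_tuples) (simp add: tuples_def)

lemma finite_offdiag: "finite (offdiag m i)"
  by (simp add: offdiag_def finite_tuples)

lemma r_plus_bounds:
  shows "0 \<le> r_plus m A i" and "js \<in> offdiag m i \<Longrightarrow> A (i # js) \<le> r_plus m A i"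
  unfolding r_plus_def by (auto simp: finite_offdiag)

lemma r_minus_bounds:
  shows "r_minus m A i \<le> 0" and "js \<in> offdiag m i \<Longrightarrow> r_minus m A i \<le> A (i # js)"
  unfolding r_minus_def by (auto simp: finite_offdiag)

lemma eigenvector_normalized:
  fixes A :: "'n::finite tensor"
  assumes "H_eigenvalue m A l"
  obtains i y where "y i = 1" "\<And>j. \<bar>y j\<bar> \<le> 1"
    "(\<Sum>js\<in>tuples (m - 1). A (i # js) * (\<Prod>j\<leftarrow>js. y j)) = l"
proof -
  obtain x where "x \<noteq> 0" and eq: "tensor_apply m A x = l *\<^sub>R vec_power x (m - 1)"
    using assms by (auto simp: H_eigenvalue_def)
  obtain i where "\<bar>x $ i\<bar> = Max (range (\<lambda>j. \<bar>x $ j\<bar>))"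
    using Max_in[of "range (\<lambda>j. \<bar>x $ j\<bar>)"] by (auto simp: image_iff)
  then have max: "\<bar>x $ j\<bar> \<le> \<bar>x $ i\<bar>" for j
    by simp
  \<comment> \<open>If the largest modulus were 0, every coordinate would vanish.\<close>
  have nz: "x $ i \<noteq> 0"
    using \<open>x \<noteq> 0\<close> max by (fastforce simp: vec_eq_iff)
  show thesis
  proof (rule that[where i = i and y = "\<lambda>j. x $ j / x $ i"])
    show "x $ i / x $ i = 1" using nz by simp
    show "\<bar>x $ j / x $ i\<bar> \<le> 1" for j using max[of j] nz by simp
    \<comment> \<open>All lists in \<open>tuples (m - 1)\<close> have the same length, so the sum is
      homogeneous of degree \<open>m - 1\<close> and rescaling the vector pulls out one common power
      of \<open>x $ i\<close>.\<close>
    have "(\<Sum>js\<in>tuples (m - 1). A (i # js) * (\<Prod>j\<leftarrow>js. x $ j / x $ i))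
        = (\<Sum>js\<in>tuples (m - 1). A (i # js) * (\<Prod>j\<leftarrow>js. x $ j)) / (x $ i) ^ (m - 1)"
      unfolding sum_divide_distrib
      by (rule sum.cong) (auto simp: prod_list_divide tuples_def)
    also have "\<dots> = l"
      using arg_cong[OF eq, of "\<lambda>v. v $ i"] nz by (simp add: tensor_apply_def vec_power_def)
    finally show "(\<Sum>js\<in>tuples (m - 1). A (i # js) * (\<Prod>j\<leftarrow>js. x $ j / x $ i)) = l" .
  qed
qed

lemma sum_power_nonneg:
  fixes y :: "'n::finite \<Rightarrow> real"
  assumes "y i = 1" and "\<And>j. \<bar>y j\<bar> \<le> 1" and "even k \<or> CARD('n) = 2"
  shows "0 \<le> (\<Sum>j\<in>UNIV. y j) ^ k"
  using assms(3)
proof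
  assume "CARD('n) = 2"
  then have "card (UNIV - {i}) = 1"
    by simp
  then obtain j where "UNIV - {i} = {j}"
    by (rule card_1_singletonE)
  then have "(\<Sum>j\<in>UNIV. y j) = y i + y j"
    using sum.remove[of UNIV i y] by simp
  also have "\<dots> \<ge> 0"
    using assms(1) assms(2)[of j] by linarith
  finally show ?thesis by simp
qed (simp add: zero_le_even_power)

theorem theorem7:
  fixes A :: "'n::finite tensor" and m :: nat and l :: real
  assumes "m \<ge> 2"
    and "H_eigenvalue m A l"
    and "odd m \<or> CARD('n) = 2"
  shows "l \<in> (\<Union>i\<in>UNIV.
    {A (replicate m i) - r_plus m A i - (\<Sum>js\<in>offdiag m i. r_plus m A i - A (i # js)) ..
     A (replicate m i) - r_minus m A i + (\<Sum>js\<in>offdiag m i. A (i # js) - r_minus m A i)})"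
proof -
  obtain i y where yi: "y i = 1" and le1: "\<And>j. \<bar>y j\<bar> \<le> 1"
    and eq: "(\<Sum>js\<in>tuples (m - 1). A (i # js) * (\<Prod>j\<leftarrow>js. y j)) = l"
    using assms(2) by (rule eigenvector_normalized) blast
  define p where "p js = (\<Prod>j\<leftarrow>js. y j)" for js
  define T where "T = (\<Sum>j\<in>UNIV. y j) ^ (m - 1)"
  have T: "0 \<le> T"
    unfolding T_def using yi le1 assms(1,3) by (intro sum_power_nonneg) auto
  have p: "p js \<le> 1" for js
    using abs_prod_list_le_1[of y js, OF le1] by (simp add: p_def)
  have diag: "p (replicate (m - 1) i) = 1" "i # replicate (m - 1) i = replicate m i"
    using assms(1) by (auto simp: p_def yi simp flip: replicate_Suc)
  \<comment> \<open>The diagonal list has monomial 1, so it contributes exactly \<open>c\<close> to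
    \<open>c * T\<close> and \<open>A (replicate m i)\<close> to \<open>l\<close>; the rest is
    off-diagonal.\<close>
  have split: "l - A (replicate m i) + c = c * T + (\<Sum>js\<in>offdiag m i. (A (i # js) - c) * p js)" for c
  proof -
    have "c * T = c + (\<Sum>js\<in>offdiag m i. c * p js)"
      unfolding T_def sum_prod_list_tuples[symmetric] p_def[symmetric]
        sum_tuples_offdiag[of _ m i] diag
      by (simp add: distrib_left sum_distrib_left)
    moreover have "l = A (replicate m i) + (\<Sum>js\<in>offdiag m i. A (i # js) * p js)"
      unfolding eq[symmetric] p_def[symmetric] sum_tuples_offdiag[of _ m i] diag
      by simp
    ultimately show ?thesis
      by (simp add: left_diff_distrib sum_subtractf)
  qed
  \<comment> \<open>The weights are nonnegative by maximality of \<open>r_plus\<close>, so replacing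
    each monomial by its upper bound 1 can only increase the sum.\<close>
  have "(\<Sum>js\<in>offdiag m i. (r_plus m A i - A (i # js)) * p js)
      \<le> (\<Sum>js\<in>offdiag m i. r_plus m A i - A (i # js))"
    by (intro sum_mono mult_left_le) (auto simp: p r_plus_bounds)
  moreover have "(\<Sum>js\<in>offdiag m i. (A (i # js) - r_plus m A i) * p js)
      = - (\<Sum>js\<in>offdiag m i. (r_plus m A i - A (i # js)) * p js)"
    by (simp add: sum_negf[symmetric] algebra_simps)
  moreover have "0 \<le> r_plus m A i * T"
    by (simp add: T r_plus_bounds)
  ultimately have "A (replicate m i) - r_plus m A i
      - (\<Sum>js\<in>offdiag m i. r_plus m A i - A (i # js)) \<le> l"
    using split[of "r_plus m A i"] by linarith
  moreover have "l \<le> A (replicate m i) - r_minus m A i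
      + (\<Sum>js\<in>offdiag m i. A (i # js) - r_minus m A i)"
  proof -
    \<comment> \<open>Here \<open>A (i # js) - c\<close> is itself a nonnegative weight, so the
      bound \<open>p js \<le> 1\<close> applies without a change of sign.\<close>
    have "(\<Sum>js\<in>offdiag m i. (A (i # js) - r_minus m A i) * p js)
        \<le> (\<Sum>js\<in>offdiag m i. A (i # js) - r_minus m A i)"
      by (intro sum_mono mult_left_le) (auto simp: p r_minus_bounds)
    moreover have "r_minus m A i * T \<le> 0"
      by (simp add: T r_minus_bounds mult_nonpos_nonneg)
    ultimately show ?thesis
      using split[of "r_minus m A i"] by linarith
  qed
  ultimately show ?thesis by auto
qed

end
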